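(* Let $\mathbf{k}$ be a unitary commutative ring, $\Omega$ a nonempty set, and let $(A,\{\prec_\omega,\succ_\omega,\cdot_\omega\mid\omega\in\Omega\})$ be a matching tridendriform algebra. Define $$x\star_\omega y:=x\cdot_\omega y,\qquad x\circ_\omega y:=x\succ_\omega y-y\prec_\omega x,\qquad x,y\in A,\ \omega\in\Omega .$$ Then $(A,\{\star_\omega,\circ_\omega\mid\omega\in\Omega\})$ is a matching associative PostLie algebra.
   Context: All modules are over $\mathbf{k}$ and all binary operations are $\mathbf{k}$-bilinear. A matching tridendriform algebra is a module $T$ with binary operations $\{\prec_\omega,\succ_\omega,\cdot_\omega\mid\omega\in\Omega\}$ such that for all $x,y,z\in T$ and $\alpha,\beta\in\Omega$: $$(x\prec_\alpha y)\prec_\beta z=x\prec_\alpha(y\prec_\beta z)+x\prec_\beta(y\succ_\alpha z)+x\prec_\alpha(y\cdot_\beta z),$$ $$(x\succ_\alpha y)\prec_\beta z=x\succ_\alpha(y\prec_\beta z),$$ $$x\succ_\alpha(y\succ_\beta z)=(x\prec_\beta y)\succ_\alpha z+(x\succ_\alpha y)\succ_\beta z+(x\cdot_\beta y)\succ_\alpha z,$$ $$(x\succ_\alpha y)\cdot_\beta z=x\succ_\alpha(y\cdot_\beta z),$$ $$(x\prec_\alpha y)\cdot_\beta z=x\cdot_\beta(y\succ_\alpha z),$$ $$(x\cdot_\alpha y)\prec_\beta z=x\cdot_\alpha(y\prec_\beta z),$$ $$(x\cdot_\alpha y)\cdot_\beta z=x\cdot_\alpha(y\cdot_\beta z).$$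 A matching associative algebra is a module $A$ with binary operations $\{\star_\omega\mid\omega\in\Omega\}$ such that $(x\star_\alpha y)\star_\beta z=x\star_\alpha(y\star_\beta z)$ for all $x,y,z\in A$, $\alpha,\beta\in\Omega$. A matching (left) associative PostLie algebra is a pair $(A,\{\star_\omega,\circ_\omega\mid\omega\in\Omega\})$ consisting of a matching associative algebra $(A,\{\star_\omega\mid\omega\in\Omega\})$ and binary operations $\circ_\omega$, $\omega\in\Omega$, on $A$ such that for all $x,y,z\in A$ and $\alpha,\beta\in\Omega$: $$x\circ_\alpha(y\circ_\beta z)-(x\circ_\alpha y)\circ_\beta z-y\circ_\beta(x\circ_\alpha z)+(y\circ_\beta x)\circ_\alpha z=(x\star_\beta y)\circ_\alpha z-(y\star_\alpha x)\circ_\beta z,$$ $$x\circ_\alpha(y\star_\beta z)-x\circ_\alpha(z\star_\beta y)=(x\circ_\alpha y)\star_\beta z-z\star_\beta(x\circ_\alpha y)+y\star_\beta(x\circ_\alpha z)-(x\circ_\alpha z)\star_\beta y.$$ *)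

theory Defs
  imports "HOL-Algebra.Module"
begin

text \<open>
  A unitary commutative ring \<open>R\<close> (the zero ring is allowed) and an \<open>R\<close>-module \<open>M\<close> are given by
  the locale \<^locale>\<open>module\<close>. The record type of \<open>M\<close> also has fields for a multiplication and a
  unit; these are unconstrained and play no role. A family of binary operations indexed by
  \<open>\<Omega>\<close> is a function \<open>op\<close>, where \<open>op \<omega> x y\<close> stands for the infix \<open>x op\<^sub>\<omega> y\<close>; only its values at
  \<open>\<omega> \<in> \<Omega>\<close> and at arguments from the carrier of \<open>M\<close> matter.
\<close>

definition bilinear_op ::
  "('a, 'r) ring_scheme \<Rightarrow> ('a, 'b, 'm) module_scheme \<Rightarrow> ('b \<Rightarrow> 'b \<Rightarrow> 'b) \<Rightarrow> bool"
  where "bilinear_op R M f \<longleftrightarrow>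
    (\<forall>x \<in> carrier M. \<forall>y \<in> carrier M. f x y \<in> carrier M) \<and>
    (\<forall>x \<in> carrier M. \<forall>y \<in> carrier M. \<forall>z \<in> carrier M.
       f (x \<oplus>\<^bsub>M\<^esub> y) z = f x z \<oplus>\<^bsub>M\<^esub> f y z \<and>
       f x (y \<oplus>\<^bsub>M\<^esub> z) = f x y \<oplus>\<^bsub>M\<^esub> f x z) \<and>
    (\<forall>c \<in> carrier R. \<forall>x \<in> carrier M. \<forall>y \<in> carrier M.
       f (c \<odot>\<^bsub>M\<^esub> x) y = c \<odot>\<^bsub>M\<^esub> f x y \<and>
       f x (c \<odot>\<^bsub>M\<^esub> y) = c \<odot>\<^bsub>M\<^esub> f x y)"

locale matching_tridendriform_algebra = module R M
  for R :: "('a, 'r) ring_scheme" and M :: "('a, 'b, 'm) module_scheme" +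
  fixes \<Omega> :: "'w set"
    and prec succ dot :: "'w \<Rightarrow> 'b \<Rightarrow> 'b \<Rightarrow> 'b"
  assumes prec_bilinear: "\<omega> \<in> \<Omega> \<Longrightarrow> bilinear_op R M (prec \<omega>)"
    and succ_bilinear: "\<omega> \<in> \<Omega> \<Longrightarrow> bilinear_op R M (succ \<omega>)"
    and dot_bilinear: "\<omega> \<in> \<Omega> \<Longrightarrow> bilinear_op R M (dot \<omega>)"
    and prec_prec:
      "\<lbrakk>\<alpha> \<in> \<Omega>; \<beta> \<in> \<Omega>; x \<in> carrier M; y \<in> carrier M; z \<in> carrier M\<rbrakk> \<Longrightarrow>
       prec \<beta> (prec \<alpha> x y) z =
         prec \<alpha> x (prec \<beta> y z) \<oplus>\<^bsub>M\<^esub> prec \<beta> x (succ \<alpha> y z) \<oplus>\<^bsub>M\<^esub> prec \<alpha> x (dot \<beta> y z)"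
    and succ_prec:
      "\<lbrakk>\<alpha> \<in> \<Omega>; \<beta> \<in> \<Omega>; x \<in> carrier M; y \<in> carrier M; z \<in> carrier M\<rbrakk> \<Longrightarrow>
       prec \<beta> (succ \<alpha> x y) z = succ \<alpha> x (prec \<beta> y z)"
    and succ_succ:
      "\<lbrakk>\<alpha> \<in> \<Omega>; \<beta> \<in> \<Omega>; x \<in> carrier M; y \<in> carrier M; z \<in> carrier M\<rbrakk> \<Longrightarrow>
       succ \<alpha> x (succ \<beta> y z) =
         succ \<alpha> (prec \<beta> x y) z \<oplus>\<^bsub>M\<^esub> succ \<beta> (succ \<alpha> x y) z \<oplus>\<^bsub>M\<^esub> succ \<alpha> (dot \<beta> x y) z"
    and succ_dot:
      "\<lbrakk>\<alpha> \<in> \<Omega>; \<beta> \<in> \<Omega>; x \<in> carrier M; y \<in> carrier M; z \<in> carrier M\<rbrakk> \<Longrightarrow>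
       dot \<beta> (succ \<alpha> x y) z = succ \<alpha> x (dot \<beta> y z)"
    and prec_dot:
      "\<lbrakk>\<alpha> \<in> \<Omega>; \<beta> \<in> \<Omega>; x \<in> carrier M; y \<in> carrier M; z \<in> carrier M\<rbrakk> \<Longrightarrow>
       dot \<beta> (prec \<alpha> x y) z = dot \<beta> x (succ \<alpha> y z)"
    and dot_prec:
      "\<lbrakk>\<alpha> \<in> \<Omega>; \<beta> \<in> \<Omega>; x \<in> carrier M; y \<in> carrier M; z \<in> carrier M\<rbrakk> \<Longrightarrow>
       prec \<beta> (dot \<alpha> x y) z = dot \<alpha> x (prec \<beta> y z)"
    and dot_dot:
      "\<lbrakk>\<alpha> \<in> \<Omega>; \<beta> \<in> \<Omega>; x \<in> carrier M; y \<in> carrier M; z \<in> carrier M\<rbrakk> \<Longrightarrow>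
       dot \<beta> (dot \<alpha> x y) z = dot \<alpha> x (dot \<beta> y z)"

locale matching_associative_algebra = module R M
  for R :: "('a, 'r) ring_scheme" and M :: "('a, 'b, 'm) module_scheme" +
  fixes \<Omega> :: "'w set"
    and star :: "'w \<Rightarrow> 'b \<Rightarrow> 'b \<Rightarrow> 'b"
  assumes star_bilinear: "\<omega> \<in> \<Omega> \<Longrightarrow> bilinear_op R M (star \<omega>)"
    and star_star:
      "\<lbrakk>\<alpha> \<in> \<Omega>; \<beta> \<in> \<Omega>; x \<in> carrier M; y \<in> carrier M; z \<in> carrier M\<rbrakk> \<Longrightarrow>
       star \<beta> (star \<alpha> x y) z = star \<alpha> x (star \<beta> y z)"

locale matching_associative_PostLie_algebra = matching_associative_algebra R M \<Omega> star
  for R :: "('a, 'r) ring_scheme" and M :: "('a, 'b, 'm) module_scheme"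
    and \<Omega> :: "'w set" and star :: "'w \<Rightarrow> 'b \<Rightarrow> 'b \<Rightarrow> 'b" +
  fixes circ :: "'w \<Rightarrow> 'b \<Rightarrow> 'b \<Rightarrow> 'b"
  assumes circ_bilinear: "\<omega> \<in> \<Omega> \<Longrightarrow> bilinear_op R M (circ \<omega>)"
    and circ_circ:
      "\<lbrakk>\<alpha> \<in> \<Omega>; \<beta> \<in> \<Omega>; x \<in> carrier M; y \<in> carrier M; z \<in> carrier M\<rbrakk> \<Longrightarrow>
       circ \<alpha> x (circ \<beta> y z) \<ominus>\<^bsub>M\<^esub> circ \<beta> (circ \<alpha> x y) z
         \<ominus>\<^bsub>M\<^esub> circ \<beta> y (circ \<alpha> x z) \<oplus>\<^bsub>M\<^esub> circ \<alpha> (circ \<beta> y x) z =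
       circ \<alpha> (star \<beta> x y) z \<ominus>\<^bsub>M\<^esub> circ \<beta> (star \<alpha> y x) z"
    and circ_star:
      "\<lbrakk>\<alpha> \<in> \<Omega>; \<beta> \<in> \<Omega>; x \<in> carrier M; y \<in> carrier M; z \<in> carrier M\<rbrakk> \<Longrightarrow>
       circ \<alpha> x (star \<beta> y z) \<ominus>\<^bsub>M\<^esub> circ \<alpha> x (star \<beta> z y) =
       star \<beta> (circ \<alpha> x y) z \<ominus>\<^bsub>M\<^esub> star \<beta> z (circ \<alpha> x y)
         \<oplus>\<^bsub>M\<^esub> star \<beta> y (circ \<alpha> x z) \<ominus>\<^bsub>M\<^esub> star \<beta> (circ \<alpha> x z) y"

end

theory Submission
  imports Defs
begin

text \<open>Expand each \<open>circ\<close> by bilinearity and sort the resulting monomials by the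
  place of one variable. In the first PostLie identity this variable is \<open>z\<close>: monomials
  ending in \<open>z\<close> collapse by \<open>succ_succ\<close>, those beginning with
  \<open>z\<close> by \<open>prec_prec\<close>, and those with \<open>z\<close> in the middle cancel
  by \<open>succ_prec\<close>; only \<open>dot\<close> terms survive (\<open>circ_circ_dot\<close>).
  In the second it is \<open>x\<close>: with \<open>x\<close> in the middle they cancel by
  \<open>prec_dot\<close>, with \<open>x\<close> outside they are moved by \<open>succ_dot\<close>
  and \<open>dot_prec\<close> (\<open>circ_dot\<close>). Associativity of the product is
  \<open>dot_dot\<close> itself, and \<open>circ\<close> is bilinear as a difference of bilinear
  maps.\<close>

context abelian_group
begin

lemma diff_eq_eq:
  assumes "x \<in> carrier G" "y \<in> carrier G" "z \<in> carrier G"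
  shows "x \<ominus> y = z \<longleftrightarrow> x = z \<oplus> y"
proof
  assume "x \<ominus> y = z"
  then have "z \<oplus> y = x \<ominus> y \<oplus> y"
    by simp
  then show "x = z \<oplus> y"
    using assms by (simp add: minus_eq a_assoc l_neg)
next
  assume "x = z \<oplus> y"
  then show "x \<ominus> y = z"
    using assms by (simp add: minus_eq a_assoc r_neg)
qed

lemma eq_diff_eq:
  assumes "x \<in> carrier G" "y \<in> carrier G" "z \<in> carrier G"
  shows "z = x \<ominus> y \<longleftrightarrow> z \<oplus> y = x"
  using diff_eq_eq[OF assms] by (metis (lifting))

lemma add_diff_eq:
  assumes "x \<in> carrier G" "y \<in> carrier G" "z \<in> carrier G"
  shows "x \<oplus> (y \<ominus> z) = x \<oplus> y \<ominus> z"
  using assms by (simp add: minus_eq a_assoc)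

lemma diff_add_eq:
  assumes "x \<in> carrier G" "y \<in> carrier G" "z \<in> carrier G"
  shows "x \<ominus> y \<oplus> z = x \<oplus> z \<ominus> y"
  using assms by (simp add: minus_eq a_ac)

lemma diff_diff_eq:
  assumes "x \<in> carrier G" "y \<in> carrier G" "z \<in> carrier G"
  shows "x \<ominus> y \<ominus> z = x \<ominus> (y \<oplus> z)"
  using assms by (simp add: minus_eq minus_add a_assoc)

lemma diff_diff_eq2:
  assumes "x \<in> carrier G" "y \<in> carrier G" "z \<in> carrier G"
  shows "x \<ominus> (y \<ominus> z) = x \<oplus> z \<ominus> y"
  using assms by (simp add: minus_eq minus_add a_ac)

text \<open>These rules carry subtracted terms across the equation, leaving sums on both sides that
  \<open>a_ac\<close> sorts. An identity valid in the free abelian group on its monomials then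
  closes without any cancellation rule.\<close>

lemmas group_simps =
  diff_eq_eq eq_diff_eq add_diff_eq diff_add_eq diff_diff_eq diff_diff_eq2 a_ac

end

context module
begin

lemma bilinear_op_closed:
  assumes "bilinear_op R M f" "x \<in> carrier M" "y \<in> carrier M"
  shows "f x y \<in> carrier M"
  using assms by (simp add: bilinear_op_def)

lemma bilinear_op_minus_left:
  assumes f: "bilinear_op R M f"
    and x: "x \<in> carrier M" and y: "y \<in> carrier M" and z: "z \<in> carrier M"
  shows "f (x \<ominus>\<^bsub>M\<^esub> y) z = f x z \<ominus>\<^bsub>M\<^esub> f y z"
proof -
  \<comment> \<open>Only additivity is available, so the difference is found by adding
    \<open>f y z\<close> back.\<close>
  have "f (x \<ominus>\<^bsub>M\<^esub> y) z \<oplus>\<^bsub>M\<^esub> f y z = f (x \<ominus>\<^bsub>M\<^esub> y \<oplus>\<^bsub>M\<^esub> y) z"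
    using f x y z by (simp add: bilinear_op_def)
  also have "x \<ominus>\<^bsub>M\<^esub> y \<oplus>\<^bsub>M\<^esub> y = x"
    using x y by (simp add: M.minus_eq M.a_assoc M.l_neg)
  finally have "f x z \<ominus>\<^bsub>M\<^esub> f y z = f (x \<ominus>\<^bsub>M\<^esub> y) z \<oplus>\<^bsub>M\<^esub> f y z \<ominus>\<^bsub>M\<^esub> f y z"
    by simp
  then show ?thesis
    using f x y z by (simp add: bilinear_op_closed M.minus_eq M.a_assoc M.r_neg)
qed

text \<open>Transfers left-hand facts to the right argument, and covers the reversed arguments of
  \<open>prec\<close> in \<open>circ\<close>.\<close>

lemma bilinear_op_swap:
  "bilinear_op R M f \<Longrightarrow> bilinear_op R M (\<lambda>x y. f y x)"
  by (simp add: bilinear_op_def)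

lemma bilinear_op_minus_right:
  assumes "bilinear_op R M f" "x \<in> carrier M" "y \<in> carrier M" "z \<in> carrier M"
  shows "f z (x \<ominus>\<^bsub>M\<^esub> y) = f z x \<ominus>\<^bsub>M\<^esub> f z y"
  using bilinear_op_minus_left[OF bilinear_op_swap[OF assms(1)]] assms(2-) by simp

lemma smult_minus_distrib:
  assumes "c \<in> carrier R" "x \<in> carrier M" "y \<in> carrier M"
  shows "c \<odot>\<^bsub>M\<^esub> (x \<ominus>\<^bsub>M\<^esub> y) = c \<odot>\<^bsub>M\<^esub> x \<ominus>\<^bsub>M\<^esub> c \<odot>\<^bsub>M\<^esub> y"
  using assms by (simp add: M.minus_eq smult_r_distr smult_r_minus)

lemma bilinear_op_diff:
  assumes "bilinear_op R M f" "bilinear_op R M g"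
  shows "bilinear_op R M (\<lambda>x y. f x y \<ominus>\<^bsub>M\<^esub> g x y)"
  using assms unfolding bilinear_op_def
  by (simp add: smult_minus_distrib M.group_simps)

end

context matching_tridendriform_algebra
begin

text \<open>As an abbreviation it leaves the differences visible to \<open>op_minus\<close>, and the
  lemmas below match the operation of the theorem literally.\<close>

abbreviation (input) circ where
  "circ \<omega> x y \<equiv> succ \<omega> x y \<ominus>\<^bsub>M\<^esub> prec \<omega> y x"

lemmas op_closed =
  bilinear_op_closed[OF prec_bilinear] bilinear_op_closed[OF succ_bilinear]
  bilinear_op_closed[OF dot_bilinear]

lemmas op_minus =
  bilinear_op_minus_left[OF prec_bilinear] bilinear_op_minus_right[OF prec_bilinear]
  bilinear_op_minus_left[OF succ_bilinear] bilinear_op_minus_right[OF succ_bilinear]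
  bilinear_op_minus_left[OF dot_bilinear] bilinear_op_minus_right[OF dot_bilinear]

text \<open>For example, \<open>succ_succ\<close> turns
  \<open>succ \<alpha> x (succ \<beta> y z)\<close>, less the two subtracted terms
  \<open>succ \<beta> (succ \<alpha> x y) z\<close> and
  \<open>succ \<alpha> (prec \<beta> x y) z\<close>, into
  \<open>succ \<alpha> (dot \<beta> x y) z\<close>.\<close>

lemma circ_circ_dot:
  assumes "\<alpha> \<in> \<Omega>" "\<beta> \<in> \<Omega>" "x \<in> carrier M" "y \<in> carrier M" "z \<in> carrier M"
  shows "circ \<alpha> x (circ \<beta> y z) \<ominus>\<^bsub>M\<^esub> circ \<beta> (circ \<alpha> x y) z
      \<ominus>\<^bsub>M\<^esub> circ \<beta> y (circ \<alpha> x z) \<oplus>\<^bsub>M\<^esub> circ \<alpha> (circ \<beta> y x) z =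
    circ \<alpha> (dot \<beta> x y) z \<ominus>\<^bsub>M\<^esub> circ \<beta> (dot \<alpha> y x) z"
  using assms
  by (simp add: op_closed op_minus prec_prec succ_prec succ_succ M.group_simps)

text \<open>The right side has eight monomials. Two pairs such as
  \<open>dot \<beta> (prec \<alpha> y x) z\<close> and
  \<open>dot \<beta> y (succ \<alpha> x z)\<close> cancel; the other four are those on the
  left.\<close>

lemma circ_dot:
  assumes "\<alpha> \<in> \<Omega>" "\<beta> \<in> \<Omega>" "x \<in> carrier M" "y \<in> carrier M" "z \<in> carrier M"
  shows "circ \<alpha> x (dot \<beta> y z) \<ominus>\<^bsub>M\<^esub> circ \<alpha> x (dot \<beta> z y) =
    dot \<beta> (circ \<alpha> x y) z \<ominus>\<^bsub>M\<^esub> dot \<beta> z (circ \<alpha> x y)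
      \<oplus>\<^bsub>M\<^esub> dot \<beta> y (circ \<alpha> x z) \<ominus>\<^bsub>M\<^esub> dot \<beta> (circ \<alpha> x z) y"
  using assms
  by (simp add: op_closed op_minus succ_dot prec_dot dot_prec M.group_simps)

end

theorem theorem4p12:
  fixes R :: "('a, 'r) ring_scheme" and A :: "('a, 'b, 'm) module_scheme"
    and \<Omega> :: "'w set"
    and prec succ dot :: "'w \<Rightarrow> 'b \<Rightarrow> 'b \<Rightarrow> 'b"
  assumes "\<Omega> \<noteq> {}"
    and "matching_tridendriform_algebra R A \<Omega> prec succ dot"
  shows "matching_associative_PostLie_algebra R A \<Omega>
    (\<lambda>\<omega> x y. dot \<omega> x y)
    (\<lambda>\<omega> x y. succ \<omega> x y \<ominus>\<^bsub>A\<^esub> prec \<omega> y x)"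
proof -
  interpret matching_tridendriform_algebra R A \<Omega> prec succ dot
    by (fact assms(2))
  show ?thesis
  proof unfold_locales
    show "bilinear_op R A (\<lambda>x y. succ \<omega> x y \<ominus>\<^bsub>A\<^esub> prec \<omega> y x)" if "\<omega> \<in> \<Omega>" for \<omega>
      using that
      by (simp add: bilinear_op_diff[OF succ_bilinear bilinear_op_swap[OF prec_bilinear]])
  \<comment> \<open>The module axioms come from the interpretation, so only the algebraic identities
    and the bilinearity of \<open>dot\<close> remain.\<close>
  qed (fact dot_bilinear dot_dot circ_circ_dot circ_dot)+
qed

end
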